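(* Let $p$ be a prime number and $c$ an integer prime to $p$. Then, for all integers $a,b\geq 0$ and $k\geq 1$, \[ N_{2k}'\cdot p^b(c^{2k}-1)\equiv D_{2k}'\cdot c^{2k-1}\sum_{s=0}^{p^{a+b}-1}s^{2k-1}\left[\frac{sc}{p^a}\right]\pmod{p^{a+b}}. \]
   Context: Bernoulli numbers: $B_{2k}$ ($k\ge 1$) is defined by $\frac{z}{e^z-1}+\frac{z}{2}=1+\sum_{k=1}^{\infty}\frac{B_{2k}}{(2k)!}z^{2k}$, so $B_2=1/6$, $B_4=-1/30$. The integers $N_{2k}',D_{2k}'$ are defined by $\frac{B_{2k}}{2k}=\frac{N_{2k}'}{D_{2k}'}$, $\gcd(N_{2k}',D_{2k}')=1$, $D_{2k}'>0$. For a real number $x$, $[x]$ denotes the greatest integer not exceeding $x$. *)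

theory Defs
  imports
    "HOL-Number_Theory.Number_Theory"
    "HOL-Computational_Algebra.Formal_Power_Series"
    Complex_Main
begin

text \<open>
  The quotient below is a genuine power series: \<open>fps_exp 1 - 1\<close> has zero constant term and
  linear coefficient 1.
\<close>

definition bernoulli_gf :: "rat fps" where
  "bernoulli_gf = fps_X / (fps_exp 1 - 1) + fps_X / 2"

text \<open>
  Only the values at even indices \<open>n = 2 * k\<close> with \<open>k \<ge> 1\<close> are meant to be used; because of the
  summand \<open>fps_X / 2\<close>, the value at 1 is 0.
\<close>

definition bernoulli :: "nat \<Rightarrow> rat" where
  "bernoulli n = fact n * fps_nth bernoulli_gf n"

text \<open>
  Numerator and denominator of \<open>bernoulli n / n\<close> in lowest terms: \<^const>\<open>quotient_of\<close> returns a
  coprime pair with positive second component.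
\<close>

definition bernoulli_num' :: "nat \<Rightarrow> int" where
  "bernoulli_num' n = fst (quotient_of (bernoulli n / of_nat n))"

definition bernoulli_den' :: "nat \<Rightarrow> int" where
  "bernoulli_den' n = snd (quotient_of (bernoulli n / of_nat n))"

lemma bernoulli_num'_den':
  "bernoulli n / of_nat n = of_int (bernoulli_num' n) / of_int (bernoulli_den' n)"
  "coprime (bernoulli_num' n) (bernoulli_den' n)"
  "bernoulli_den' n > 0"
  unfolding bernoulli_num'_def bernoulli_den'_def
  by (simp_all add: quotient_of_div quotient_of_coprime quotient_of_denom_pos')

lemma fps_exp_minus_1_nonzero: "fps_exp (1::rat) - 1 \<noteq> 0"
proof
  assume "fps_exp (1::rat) - 1 = 0"
  then have "fps_nth (fps_exp (1::rat) - 1) 1 = 0" by simp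
  then show False by simp
qed

lemma subdegree_fps_exp_minus_1: "subdegree (fps_exp (1::rat) - 1) = 1"
  by (rule subdegreeI) auto

lemma bernoulli_gf_mult:
  "2 * (fps_exp 1 - 1) * bernoulli_gf = fps_X * (fps_exp 1 + 1)"
proof -
  have "(fps_exp (1::rat) - 1) dvd fps_X"
    by (subst fps_dvd_iff[OF fps_exp_minus_1_nonzero])
      (simp_all only: subdegree_fps_exp_minus_1 fps_X_neq_zero subdegree_fps_X not_False_eq_True order_refl)
  then have q: "(fps_exp (1::rat) - 1) * (fps_X / (fps_exp 1 - 1)) = fps_X"
    by simp
  have h: "2 * (fps_X / 2 :: rat fps) = fps_X"
    by (simp add: fps_divide_unit inverse_mult_eq_1' mult.left_commute)
  have "2 * (fps_exp 1 - 1) * bernoulli_gf =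
      2 * ((fps_exp 1 - 1) * (fps_X / (fps_exp 1 - 1))) + (fps_exp 1 - 1) * (2 * (fps_X / 2))"
    unfolding bernoulli_gf_def by (simp only: algebra_simps)
  also have "\<dots> = fps_X * (fps_exp 1 + 1)"
    unfolding q h by (simp add: algebra_simps)
  finally show ?thesis .
qed

lemma bernoulli_0: "bernoulli 0 = 1"
proof -
  have "fps_nth (2 * (fps_exp 1 - 1) * bernoulli_gf) 1 = fps_nth (fps_X * (fps_exp 1 + 1)) 1"
    by (simp only: bernoulli_gf_mult)
  then show ?thesis
    by (simp add: bernoulli_def fps_mult_nth fps_numeral_nth)
qed

lemma bernoulli_gf_even: "fps_compose bernoulli_gf (- fps_X) = bernoulli_gf"
proof -
  let ?E = "fps_exp (1::rat)" and ?G = "fps_compose bernoulli_gf (- fps_X)"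
  have c: "fps_compose (f * g) (- fps_X) = fps_compose f (- fps_X) * fps_compose g (- fps_X)"
    for f g :: "rat fps"
    by (rule fps_compose_mult_distrib) simp
  have E: "fps_compose ?E (- fps_X) = fps_exp (-1)"
    using fps_exp_compose_linear[of 1 "-1::rat"] by (simp flip: fps_const_neg)
  have inv: "?E * fps_exp (-1) = 1"
    by (simp flip: fps_exp_add_mult)
  have "fps_compose (2 * (?E - 1) * bernoulli_gf) (- fps_X) = fps_compose (fps_X * (?E + 1)) (- fps_X)"
    by (simp only: bernoulli_gf_mult)
  then have "2 * (fps_exp (-1) - 1) * ?G = - fps_X * (fps_exp (-1) + 1)"
    by (simp add: c E fps_compose_sub_distrib fps_compose_add_distrib)
  then have "?E * (2 * (fps_exp (-1) - 1) * ?G) = ?E * (- fps_X * (fps_exp (-1) + 1))"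
    by simp
  moreover have "?E * (2 * (fps_exp (-1) - 1) * ?G) = 2 * (?E * fps_exp (-1) - ?E) * ?G"
    by (simp add: right_diff_distrib left_diff_distrib mult_ac)
  moreover have "?E * (- fps_X * (fps_exp (-1) + 1)) = - fps_X * (?E * fps_exp (-1) + ?E)"
    by (simp add: distrib_left right_diff_distrib mult_ac)
  ultimately have "2 * (1 - ?E) * ?G = - fps_X * (1 + ?E)"
    by (simp only: inv)
  then have "2 * (?E - 1) * ?G = 2 * (?E - 1) * bernoulli_gf"
    unfolding bernoulli_gf_mult by (simp add: algebra_simps)
  then show ?thesis
    using fps_exp_minus_1_nonzero by simp
qed

lemma bernoulli_odd: "odd n \<Longrightarrow> bernoulli n = 0"
proof -
  assume "odd n"
  have "fps_nth (fps_compose bernoulli_gf (- fps_X)) n = (-1) ^ n * fps_nth bernoulli_gf n"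
    by (simp add: fps_compose_uminus')
  with \<open>odd n\<close> show ?thesis
    by (simp add: bernoulli_gf_even bernoulli_def)
qed

lemma bernoulli_gf_expansion:
  "fps_X / (fps_exp 1 - 1) + fps_X / 2 =
     Abs_fps (\<lambda>n. if n = 0 then 1 else if even n then bernoulli n / fact n else 0)"
  unfolding bernoulli_gf_def[symmetric]
proof (rule fps_ext)
  fix n
  have "fps_nth bernoulli_gf n = bernoulli n / fact n"
    by (simp add: bernoulli_def)
  then show "fps_nth bernoulli_gf n =
      fps_nth (Abs_fps (\<lambda>n. if n = 0 then 1 else if even n then bernoulli n / fact n else 0)) n"
    by (simp add: bernoulli_0 bernoulli_odd)
qed

end

theory Submission
  imports Defs
begin

text \<open>
  For \<open>b = 0\<close> this is Voronoi's argument. Put \<open>m = 2 * k\<close>, \<open>q = p ^ a\<close> and let \<open>r\<close> be the residue of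
  \<open>s * c\<close> modulo \<open>q\<close>, so \<open>r = s * c - q * \<lfloor>s * c / q\<rfloor>\<close>. Expanding \<open>r ^ m\<close> to first order in \<open>q\<close>, summing
  over \<open>s < q\<close> (the residues \<open>r\<close> are a permutation of the \<open>s\<close>) and dividing by \<open>m * q\<close> gives the
  congruence, with \<open>\<Sum>s<q. s ^ m\<close> in place of \<open>q * bernoulli m\<close>. Both this replacement and the
  remainder of the expansion cost denominators, which the denominator of \<open>bernoulli m / m\<close>
  absorbs: \<open>p * bernoulli n\<close> is always \<open>p\<close>-integral, and the denominator is divisible by 12, which
  takes care of \<open>p = 2\<close> and \<open>p = 3\<close>.
  For general \<open>b\<close> and \<open>a > 0\<close>, writing \<open>s = u + q * v\<close> shows that the sum, multiplied by that
  denominator, is \<open>p ^ b\<close> times the sum for \<open>b = 0\<close> modulo \<open>p ^ (a + b)\<close>.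
\<close>

subsection \<open>Rational numbers integral at a prime\<close>

text \<open>The localization of the integers at \<open>p\<close>. Asking for some multiplier
  \<open>d\<close> prime to \<open>p\<close> makes closure under sums and products a matter of
  multiplying multipliers.\<close>

definition plocal :: "nat \<Rightarrow> rat set" where
  "plocal p = {x. \<exists>d::int. \<not> int p dvd d \<and> of_int d * x \<in> \<int>}"

lemma plocalI: "\<not> int p dvd d \<Longrightarrow> of_int d * x \<in> \<int> \<Longrightarrow> x \<in> plocal p"
  by (auto simp: plocal_def)

lemma plocal_of_int [simp]: "prime p \<Longrightarrow> of_int z \<in> plocal p"
  by (rule plocalI[of _ 1]) (auto simp: prime_nat_iff)

lemma plocal_of_nat [simp]: "prime p \<Longrightarrow> of_nat z \<in> plocal p"
  using plocal_of_int[of p "int z"] by simp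

lemma plocal_numeral [simp]: "prime p \<Longrightarrow> numeral z \<in> plocal p"
  using plocal_of_int[of p "numeral z"] by simp

lemma plocal_0 [simp]: "prime p \<Longrightarrow> 0 \<in> plocal p"
  and plocal_1 [simp]: "prime p \<Longrightarrow> 1 \<in> plocal p"
  using plocal_of_int[of p 0] plocal_of_int[of p 1] by auto

lemma plocal_mult:
  assumes "prime p" "x \<in> plocal p" "y \<in> plocal p"
  shows "x * y \<in> plocal p"
proof -
  obtain d e where d: "\<not> int p dvd d" "of_int d * x \<in> \<int>"
    and e: "\<not> int p dvd e" "of_int e * y \<in> \<int>"
    using assms by (auto simp: plocal_def)
  have "(of_int d * x) * (of_int e * y) \<in> \<int>"
    by (rule Ints_mult) (fact d(2), fact e(2))
  then show ?thesis
    using d e assms(1) by (intro plocalI[of _ "d * e"]) (auto simp: prime_dvd_mult_iff mult_ac)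
qed

lemma plocal_add:
  assumes "prime p" "x \<in> plocal p" "y \<in> plocal p"
  shows "x + y \<in> plocal p"
proof -
  obtain d e where d: "\<not> int p dvd d" "of_int d * x \<in> \<int>"
    and e: "\<not> int p dvd e" "of_int e * y \<in> \<int>"
    using assms by (auto simp: plocal_def)
  have "of_int e * (of_int d * x) + of_int d * (of_int e * y) \<in> \<int>"
    by (rule Ints_add[OF Ints_mult[OF Ints_of_int d(2)] Ints_mult[OF Ints_of_int e(2)]])
  then show ?thesis
    using d e assms(1)
    by (intro plocalI[of _ "d * e"]) (auto simp: prime_dvd_mult_iff algebra_simps)
qed

lemma plocal_minus: "prime p \<Longrightarrow> x \<in> plocal p \<Longrightarrow> - x \<in> plocal p"
  using plocal_mult[of p "-1" x] plocal_of_int[of p "-1"] by simp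

lemma plocal_diff: "prime p \<Longrightarrow> x \<in> plocal p \<Longrightarrow> y \<in> plocal p \<Longrightarrow> x - y \<in> plocal p"
  using plocal_add[of p x "-y"] plocal_minus[of p y] by simp

lemma plocal_power: "prime p \<Longrightarrow> x \<in> plocal p \<Longrightarrow> x ^ n \<in> plocal p"
  by (induction n) (auto intro: plocal_mult)

lemma plocal_sum:
  "prime p \<Longrightarrow> (\<And>i. i \<in> A \<Longrightarrow> f i \<in> plocal p) \<Longrightarrow> sum f A \<in> plocal p"
  by (induction A rule: infinite_finite_induct) (auto intro: plocal_add)

lemma plocal_inverse_nat:
  assumes "\<not> p dvd d"
  shows "1 / of_nat d \<in> plocal p"
  using assms by (intro plocalI[of _ "int d"]) (auto intro!: Nat.gr0I)

text \<open>The way back to the integers: a congruence modulo \<open>p ^ n\<close> is proved by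
  showing that the difference over \<open>p ^ n\<close> is \<open>p\<close>-integral. The multiplier
  is coprime to \<open>p ^ n\<close> and cancels.\<close>

lemma plocal_dvd:
  assumes "prime p" "of_int x / of_nat (p ^ n) \<in> plocal p"
  shows "int p ^ n dvd x"
proof -
  obtain d z where d: "\<not> int p dvd d" and z: "of_int d * (of_int x / of_nat (p ^ n)) = (of_int z :: rat)"
    using assms(2) by (auto simp: plocal_def elim!: Ints_cases)
  have "(of_int (d * x) :: rat) = of_int (z * int p ^ n)"
    using z prime_gt_0_nat[OF assms(1)] by (simp add: field_simps)
  then have "d * x = z * int p ^ n"
    by (simp only: of_int_eq_iff)
  then have "int p ^ n dvd d * x" by simp
  moreover have "coprime (int p ^ n) d"
    using d assms(1) by (simp add: prime_imp_coprime)
  ultimately show ?thesis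
    by (simp add: coprime_dvd_mult_right_iff)
qed

text \<open>The size of \<open>d\<close> bounds its \<open>p\<close>-adic valuation:
  \<open>p ^ multiplicity p d\<close> is at most \<open>d\<close>, so the valuation is at most
  \<open>n\<close>.\<close>

lemma plocal_power_div:
  assumes "prime p" "0 < d" "d < p ^ Suc n"
  shows "of_nat p ^ n / of_nat d \<in> plocal p"
proof -
  obtain e where e: "d = p ^ multiplicity p d * e" "\<not> p dvd e"
    using multiplicity_decompose'[of d p] assms by (auto simp: prime_nat_iff)
  have "p ^ multiplicity p d \<le> d"
    using assms(2) by (intro dvd_imp_le multiplicity_dvd)
  then have "p ^ multiplicity p d < p ^ Suc n" using assms(3) by simp
  then have v: "multiplicity p d \<le> n"
    using prime_gt_1_nat[OF assms(1)] by (simp add: power_strict_increasing_iff del: power_Suc)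
  have p0: "(of_nat p :: rat) \<noteq> 0" using assms(1) by (auto simp: prime_nat_iff)
  have "of_nat p ^ n / of_nat d = (of_nat p ^ n / of_nat p ^ multiplicity p d) * (1 / of_nat e :: rat)"
    by (subst e(1)) simp
  also have "\<dots> = of_nat p ^ (n - multiplicity p d) * (1 / of_nat e)"
    using v p0 by (simp add: power_diff)
  also have "\<dots> \<in> plocal p"
    using assms(1) e(2) by (intro plocal_mult plocal_power plocal_inverse_nat) auto
  finally show ?thesis .
qed

text \<open>Of two consecutive numbers at most one is divisible by \<open>p\<close>, so the whole
  power is available for that one.\<close>

lemma plocal_power_div2:
  assumes "prime p" "0 < i" "i + 1 < p ^ Suc n"
  shows "of_nat p ^ n / (of_nat i * of_nat (i + 1)) \<in> plocal p"
proof (cases "p dvd i")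
  case True
  then have "\<not> p dvd i + 1"
    using assms(1) by (metis dvd_add_right_iff nat_dvd_1_iff_1 not_prime_1)
  then have "(of_nat p ^ n / of_nat i) * (1 / of_nat (i + 1)) \<in> plocal p"
    using assms by (intro plocal_mult plocal_power_div plocal_inverse_nat) auto
  then show ?thesis by simp
next
  case False
  then have "(of_nat p ^ n / of_nat (i + 1)) * (1 / of_nat i) \<in> plocal p"
    using assms by (intro plocal_mult plocal_power_div plocal_inverse_nat) auto
  then show ?thesis by (simp add: mult.commute)
qed

subsection \<open>Power sums and Bernoulli numbers\<close>

definition power_sum :: "nat \<Rightarrow> nat \<Rightarrow> int" where
  "power_sum m n = (\<Sum>s<n. int s ^ m)"

lemma sum_fps_exp:
  "(fps_exp 1 - 1) * (\<Sum>s<n. fps_exp (of_nat s)) = fps_exp (of_nat n) - (1 :: rat fps)"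
proof (induction n)
  case (Suc n)
  have "fps_exp (of_nat (Suc n)) = fps_exp 1 * fps_exp (of_nat n :: rat)"
    by (simp flip: fps_exp_add_mult)
  then show ?case using Suc by (simp add: algebra_simps)
qed simp

text \<open>Both sides agree after multiplication by \<open>fps_exp 1 - 1\<close>, which turns the
  sum into a telescoped geometric series and \<open>bernoulli_gf\<close> into a polynomial in
  \<open>fps_X\<close> and \<open>fps_exp 1\<close>.\<close>

lemma bernoulli_gf_power_sum:
  "2 * (fps_X * (\<Sum>s<n. fps_exp (of_nat s))) + fps_X * (fps_exp (of_nat n) - 1) =
    2 * (bernoulli_gf * (fps_exp (of_nat n) - 1))"
proof -
  let ?E = "fps_exp (1 :: rat)" and ?S = "\<Sum>s<n. fps_exp (of_nat s) :: rat fps"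
    and ?N = "fps_exp (of_nat n) - 1 :: rat fps"
  have "(?E - 1) * (2 * (fps_X * ?S) + fps_X * ?N) =
      2 * fps_X * ((?E - 1) * ?S) + fps_X * (?E - 1) * ?N"
    by (simp add: algebra_simps)
  also have "\<dots> = fps_X * (?E + 1) * ?N"
    unfolding sum_fps_exp by (simp add: algebra_simps)
  also have "\<dots> = (?E - 1) * (2 * (bernoulli_gf * ?N))"
    unfolding bernoulli_gf_mult[symmetric] by (simp add: algebra_simps)
  finally show ?thesis using fps_exp_minus_1_nonzero by simp
qed

text \<open>The term \<open>n ^ m / 2\<close> is due to the convention \<open>bernoulli 1 = 0\<close>.\<close>

lemma power_sum_bernoulli:
  assumes "m > 0"
  shows "of_int (power_sum m n) + of_nat n ^ m / 2 =
    (\<Sum>i\<le>m. of_nat (m choose i) * bernoulli (m - i) * of_nat n ^ (i + 1) / of_nat (i + 1))"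
proof -
  have nth: "fps_nth bernoulli_gf j = bernoulli j / fact j" for j
    by (simp add: bernoulli_def)
  have "fps_nth (2 * (fps_X * (\<Sum>s<n. fps_exp (of_nat s))) + fps_X * (fps_exp (of_nat n) - 1)) (Suc m)
    = 2 * (of_int (power_sum m n) / fact m) + (of_nat n ^ m / fact m :: rat)"
    using assms by (simp add: fps_sum_nth power_sum_def numeral_fps_const flip: sum_divide_distrib)
  moreover have "fps_nth (2 * (bernoulli_gf * (fps_exp (of_nat n) - 1))) (Suc m) =
      2 * (\<Sum>i\<le>m. bernoulli (m - i) / fact (m - i) * (of_nat n ^ (i + 1) / fact (i + 1)))"
  proof -
    have "fps_nth (bernoulli_gf * (fps_exp (of_nat n) - 1)) (Suc m) =
      (\<Sum>i=0..Suc m. fps_nth (fps_exp (of_nat n) - 1) i * fps_nth bernoulli_gf (Suc m - i))"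
      by (subst mult.commute) (rule fps_mult_nth)
    \<comment> \<open>The constant term of \<open>fps_exp (of_nat n) - 1\<close> is 0, so the index
      shifts by one.\<close>
    also have "\<dots> = (\<Sum>i=0..m. fps_nth (fps_exp (of_nat n) - 1) (Suc i) * fps_nth bernoulli_gf (m - i))"
      by (subst sum.atLeast0_atMost_Suc_shift) (simp del: fact_Suc)
    also have "\<dots> = (\<Sum>i=0..m. bernoulli (m - i) / fact (m - i) * (of_nat n ^ (i + 1) / fact (i + 1)))"
      by (rule sum.cong) (simp_all add: nth mult_ac del: fact_Suc)
    finally show ?thesis
      by (simp add: numeral_fps_const atMost_atLeast0 del: fact_Suc)
  qed
  ultimately have "2 * (of_int (power_sum m n) / fact m) + (of_nat n ^ m / fact m :: rat) =
      2 * (\<Sum>i\<le>m. bernoulli (m - i) / fact (m - i) * (of_nat n ^ (i + 1) / fact (i + 1)))"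
    by (simp only: bernoulli_gf_power_sum)
  then have "of_int (power_sum m n) + (of_nat n ^ m / 2 :: rat) =
      fact m * (\<Sum>i\<le>m. bernoulli (m - i) / fact (m - i) * (of_nat n ^ (i + 1) / fact (i + 1)))"
    by (simp add: field_simps)
  also have "\<dots> = (\<Sum>i\<le>m. of_nat (m choose i) * bernoulli (m - i) * of_nat n ^ (i + 1) / of_nat (i + 1))"
    unfolding sum_distrib_left by (rule sum.cong) (auto simp: binomial_fact field_simps)
  finally show ?thesis .
qed

text \<open>The weak form of von Staudt's theorem. In the power sum formula for \<open>n = p\<close>
  the term at \<open>i = 0\<close> is \<open>p * bernoulli m\<close>; each later term is
  \<open>p * bernoulli (m - i)\<close>, integral by induction, times a binomial coefficient and
  \<open>p ^ i / (i + 1)\<close>.\<close>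

lemma plocal_prime_mult_bernoulli:
  assumes "prime p"
  shows "of_nat p * bernoulli n \<in> plocal p"
proof (induction n rule: less_induct)
  case (less m)
  show ?case
  proof (cases "m = 0")
    case True
    then show ?thesis using assms by (simp add: bernoulli_0)
  next
    case False
    let ?f = "\<lambda>i. of_nat (m choose i) * bernoulli (m - i) * of_nat p ^ (i + 1) / of_nat (i + 1)"
    have "(\<Sum>i\<le>m. ?f i) = ?f 0 + (\<Sum>i\<in>{1..m}. ?f i)"
      by (simp add: atMost_atLeast0 sum.atLeast_Suc_atMost)
    then have "of_nat p * bernoulli m = of_int (power_sum m p) + of_nat p ^ m / 2 - (\<Sum>i\<in>{1..m}. ?f i)"
      using power_sum_bernoulli[of m p] False by (simp add: mult.commute)
    moreover have "?f i \<in> plocal p" if i: "i \<in> {1..m}" for i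
    proof -
      have "i + 1 \<le> 2 ^ i" by (simp add: Suc_leI)
      also have "2 ^ i \<le> p ^ i"
        using prime_ge_2_nat[OF assms] by (rule power_mono) simp
      also have "\<dots> < p ^ Suc i"
        using prime_gt_1_nat[OF assms] by (rule power_strict_increasing[rotated]) simp
      finally have "of_nat p ^ i / of_nat (i + 1) \<in> plocal p"
        using assms by (intro plocal_power_div) auto
      moreover have "of_nat p * bernoulli (m - i) \<in> plocal p"
        using less i False by auto
      ultimately have "of_nat (m choose i) * ((of_nat p * bernoulli (m - i)) * (of_nat p ^ i / of_nat (i + 1))) \<in> plocal p"
        by (intro plocal_mult[OF assms plocal_of_nat[OF assms] plocal_mult[OF assms]])
      then show ?thesis by (simp add: mult_ac)
    qed
    moreover have "of_nat p ^ m / 2 \<in> plocal p"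
    proof -
      have "2 < p ^ Suc m"
      proof -
        have "2 ^ 1 < (2::nat) ^ Suc m" using False by (intro power_strict_increasing) auto
        also have "\<dots> \<le> p ^ Suc m" using prime_ge_2_nat[OF assms] by (rule power_mono) simp
        finally show ?thesis by simp
      qed
      then show ?thesis using plocal_power_div[OF assms, of 2 m] by simp
    qed
    ultimately show ?thesis
      using assms by (auto intro!: plocal_add plocal_diff plocal_sum)
  qed
qed

text \<open>The term at \<open>i = 0\<close> moves to the left, and the one at \<open>i = 1\<close>
  contains \<open>bernoulli (m - 1)\<close>, which vanishes since \<open>m - 1\<close> is
  odd.\<close>

lemma power_sum_bernoulli_even:
  assumes "even m" "m > 0"
  shows "of_int (power_sum m n) - of_nat n * bernoulli m =
    (\<Sum>i=2..m. of_nat (m choose i) * bernoulli (m - i) * of_nat n ^ (i + 1) / of_nat (i + 1)) - of_nat n ^ m / 2"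
proof -
  let ?f = "\<lambda>i. of_nat (m choose i) * bernoulli (m - i) * of_nat n ^ (i + 1) / of_nat (i + 1)"
  have "{..m} = insert 0 (insert 1 {2..m})" using assms by auto
  then have "(\<Sum>i\<le>m. ?f i) = ?f 0 + ?f 1 + (\<Sum>i=2..m. ?f i)" by simp
  also have "?f 1 = 0" using assms by (simp add: bernoulli_odd)
  finally show ?thesis
    using power_sum_bernoulli[of m n] assms by (simp add: mult.commute)
qed

text \<open>Of the \<open>p ^ (i + 1)\<close> in each term, one \<open>p\<close> makes the Bernoulli
  number integral, one cancels the divisor, and \<open>p ^ (i - 1)\<close> is left against
  \<open>i + 1\<close>.\<close>

lemma power_sum_cong_bernoulli:
  assumes "prime p" "even m" "m > 0"
  shows "(of_int (power_sum m p) - of_nat p * bernoulli m) / of_nat p \<in> plocal p"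
proof -
  have p2: "p \<ge> 2" using assms(1) by (rule prime_ge_2_nat)
  have p0: "(of_nat p :: rat) \<noteq> 0" using p2 by simp
  have m2: "m \<ge> 2" using assms by (auto elim!: evenE)
  let ?f = "\<lambda>i. of_nat (m choose i) * bernoulli (m - i) * of_nat p ^ (i + 1) / of_nat (i + 1)"
  have "?f i / of_nat p \<in> plocal p" if i: "i \<in> {2..m}" for i
  proof -
    \<comment> \<open>This bound fails at \<open>i = 1\<close>, which is why the vanishing of that
      term matters.\<close>
    have "i + 1 < 2 ^ i" using i
    proof (induction i)
      case (Suc i)
      then show ?case by (cases "i = 1") auto
    qed simp
    also have "2 ^ i \<le> p ^ Suc (i - 1)"
      using p2 i by (simp add: power_mono)
    finally have "of_nat p ^ (i - 1) / of_nat (i + 1) \<in> plocal p"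
      using assms(1) by (intro plocal_power_div) auto
    then have *: "of_nat (m choose i) * ((of_nat p * bernoulli (m - i)) * (of_nat p ^ (i - 1) / of_nat (i + 1))) \<in> plocal p"
      using assms(1) by (intro plocal_mult plocal_of_nat plocal_prime_mult_bernoulli)
    have "of_nat p ^ (i + 1) = of_nat p * of_nat p * (of_nat p ^ (i - 1) :: rat)"
      using i by (cases i) auto
    then have "?f i / of_nat p = of_nat (m choose i) * ((of_nat p * bernoulli (m - i)) * (of_nat p ^ (i - 1) / of_nat (i + 1)))"
      using p0 by (simp add: mult_ac)
    with * show ?thesis by simp
  qed
  moreover have "of_nat p ^ m / 2 / of_nat p \<in> plocal p"
  proof -
    have "2 < (2::nat) ^ Suc (m - 1)" using m2 power_strict_increasing[of 1 m "2::nat"] by simp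
    also have "\<dots> \<le> p ^ Suc (m - 1)" using p2 by (rule power_mono) simp
    finally have "of_nat p ^ (m - 1) / of_nat 2 \<in> plocal p"
      using assms(1) by (intro plocal_power_div) auto
    moreover have "of_nat p ^ m = of_nat p * (of_nat p ^ (m - 1) :: rat)"
      using m2 by (cases m) auto
    ultimately show ?thesis using p0 by simp
  qed
  ultimately show ?thesis
    using assms unfolding power_sum_bernoulli_even[OF assms(2,3)]
    by (auto simp: diff_divide_distrib sum_divide_distrib intro!: plocal_diff plocal_sum)
qed

section \<open>Divisibility of the denominator by 12, and the denominators it absorbs\<close>

lemma bernoulli_den'_mult:
  assumes "m > 0"
  shows "of_int (bernoulli_den' m) * bernoulli m = of_nat m * of_int (bernoulli_num' m)"
  using bernoulli_num'_den'(1)[of m] bernoulli_num'_den'(3)[of m] assms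
  by (simp add: field_simps)

text \<open>Since \<open>power_sum m 2\<close> is 1, \<open>2 * bernoulli m\<close> is 1 minus an
  even 2-integral number. As \<open>m\<close> is even, the relation between numerator and
  denominator then makes the denominator even.\<close>

lemma four_dvd_bernoulli_den':
  assumes "even m" "m > 0"
  shows "4 dvd bernoulli_den' m"
proof -
  let ?D = "bernoulli_den' m"
  have two: "prime (2::nat)" by simp
  have "power_sum m 2 = 1"
    using assms by (simp add: power_sum_def numeral_2_eq_2)
  moreover define x where "x = (1 - 2 * bernoulli m) / 2"
  ultimately have x: "x \<in> plocal 2"
    using power_sum_cong_bernoulli[OF two assms] unfolding x_def by simp
  have B: "bernoulli m = (1 - 2 * x) / 2"
    by (simp add: x_def field_simps)
  obtain l where l: "m = 2 * l" using assms by blast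
  have D: "of_int ?D = 4 * (of_nat l * of_int (bernoulli_num' m)) + 2 * x * of_int ?D"
    using bernoulli_den'_mult[OF assms(2), unfolded B] l by (simp add: field_simps)
  define y where "y = 2 * (of_nat l * of_int (bernoulli_num' m)) + x * of_int ?D"
  have y: "y \<in> plocal 2"
    unfolding y_def using x by (intro plocal_add plocal_mult) auto
  have Dy: "of_int ?D = 2 * y" using D by (simp add: y_def)
  \<comment> \<open>Feeding \<open>Dy\<close> back into the right-hand side of \<open>D\<close>
    raises the divisibility from 2 to 4.\<close>
  have "of_int ?D = 4 * (of_nat l * of_int (bernoulli_num' m)) + 2 * x * (2 * y)"
    using D Dy by simp
  then have "of_int ?D / of_nat (2 ^ 2) = of_nat l * of_int (bernoulli_num' m) + x * y"
    by simp
  also have "\<dots> \<in> plocal 2"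
    using x y by (intro plocal_add plocal_mult) auto
  finally show ?thesis using plocal_dvd[OF two, of ?D 2] by simp
qed

text \<open>Modulo 3 the power sum is 2, so \<open>3 * bernoulli m\<close> is a unit at 3, while its
  product with the denominator is \<open>3 * m\<close> times the numerator.\<close>

lemma three_dvd_bernoulli_den':
  assumes "even m" "m > 0"
  shows "3 dvd bernoulli_den' m"
proof -
  let ?D = "bernoulli_den' m"
  have three: "prime (3::nat)" by simp
  obtain l where l: "m = 2 * l" using assms by blast
  have "power_sum m 3 = 1 + 4 ^ l"
    using assms by (simp add: power_sum_def numeral_3_eq_3 l power_mult)
  moreover have "3 dvd (4 ^ l - 1 :: int)"
    using cong_pow[of "4::int" 1 3 l] by (simp add: cong_iff_dvd_diff)
  ultimately obtain z where z: "power_sum m 3 = 2 + 3 * z"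
    by (auto elim!: dvdE simp: algebra_simps)
  define x where "x = (2 + 3 * of_int z - 3 * bernoulli m) / 3"
  have x: "x \<in> plocal 3"
    using power_sum_cong_bernoulli[OF three assms] by (simp add: x_def z)
  have "3 * x = 2 + 3 * of_int z - 3 * bernoulli m"
    by (simp add: x_def)
  then have B: "bernoulli m = (2 + 3 * of_int z - 3 * x) / 3"
    by simp
  have "of_int (2 * ?D) / of_nat (3 ^ 1) =
    of_nat m * of_int (bernoulli_num' m) - of_int z * of_int ?D + x * of_int ?D"
    using bernoulli_den'_mult[OF assms(2)] by (simp add: B field_simps)
  also have "\<dots> \<in> plocal 3"
    using x by (intro plocal_add plocal_diff plocal_mult) auto
  finally have "3 dvd 2 * ?D" using plocal_dvd[OF three, of "2 * ?D" 1] by simp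
  then show ?thesis by presburger
qed

lemma twelve_dvd_bernoulli_den':
  assumes "even m" "m > 0"
  shows "12 dvd bernoulli_den' m"
  using four_dvd_bernoulli_den'[OF assms] three_dvd_bernoulli_den'[OF assms] by presburger

text \<open>The divisor \<open>p\<close> is the one lent to \<open>bernoulli (m - i)\<close> in the
  application. The factor 12 returns two powers of 2 for \<open>p = 2\<close> and one power of 3 for
  \<open>p = 3\<close>; for \<open>p\<close> at least 5 the remaining \<open>p ^ (i - 2)\<close> is
  enough.\<close>

lemma plocal_twelve_power_div:
  assumes "prime p" "i \<ge> 2"
  shows "12 / of_nat p * (of_nat p ^ (i - 1) / (of_nat i * of_nat (i + 1))) \<in> plocal p"
proof -
  obtain j where j: "i = j + 2" using assms(2) by (metis le_add_diff_inverse2)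
  consider "p = 2" | "p = 3" | "p \<ge> 5"
    using prime_ge_2_nat[OF assms(1)] assms(1) by (cases "p = 4") force+
  then show ?thesis
  proof cases
    case 1
    have "i + 1 < 2 ^ Suc i" by (induction i) auto
    then have "3 * (of_nat 2 ^ i / (of_nat i * of_nat (i + 1))) \<in> plocal 2"
      using assms by (intro plocal_mult plocal_power_div2) auto
    then show ?thesis by (simp add: 1 j)
  next
    case 2
    have "j + 3 < 3 ^ (j + 2)" by (induction j) auto
    then have "4 * (of_nat 3 ^ (i - 1) / (of_nat i * of_nat (i + 1))) \<in> plocal 3"
      using assms by (intro plocal_mult plocal_power_div2) (auto simp: j)
    then show ?thesis by (simp add: 2)
  next
    case 3
    have "j + 3 < 5 ^ Suc j" by (induction j) auto
    also have "\<dots> \<le> p ^ Suc j" using 3 by (rule power_mono) simp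
    finally have "12 * (of_nat p ^ j / (of_nat i * of_nat (i + 1))) \<in> plocal p"
      using assms by (intro plocal_mult plocal_power_div2) (auto simp: j)
    then show ?thesis using 3 by (simp add: j)
  qed
qed

text \<open>For \<open>p = 2\<close> the factor 6 raises the power to \<open>2 ^ (i - 1)\<close>;
  for odd \<open>p\<close> already \<open>i < p ^ (i - 1)\<close>.\<close>

lemma plocal_six_power_div:
  assumes "prime p" "i \<ge> 2"
  shows "6 * (of_nat p ^ (i - 2) / of_nat i) \<in> plocal p"
proof -
  obtain j where j: "i = j + 2" using assms(2) by (metis le_add_diff_inverse2)
  show ?thesis
  proof (cases "p = 2")
    case True
    have "j + 2 < 2 ^ Suc (j + 1)" by (induction j) auto
    then have "3 * (of_nat 2 ^ (j + 1) / of_nat i) \<in> plocal 2"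
      using assms by (intro plocal_mult plocal_power_div) (auto simp: j)
    then show ?thesis by (simp add: True j)
  next
    case False
    then have "p \<ge> 3" using prime_ge_2_nat[OF assms(1)] by simp
    have "j + 2 < 3 ^ Suc j" by (induction j) auto
    also have "\<dots> \<le> p ^ Suc j" using \<open>p \<ge> 3\<close> by (rule power_mono) simp
    finally show ?thesis
      using assms by (intro plocal_mult plocal_power_div) (auto simp: j)
  qed
qed

text \<open>The error of replacing the power sum by \<open>q * bernoulli m\<close>, where
  \<open>q = p ^ a\<close>, survives division by \<open>m * q ^ 2\<close>: absorbing
  \<open>m\<close> into the binomial coefficient leaves the denominator \<open>i * (i + 1)\<close>,
  for which the factor 12 of \<open>bernoulli_den' m\<close> pays.\<close>

lemma den'_power_sum_bernoulli:
  assumes "prime p" "even m" "m > 0" "a > 0"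
  shows "of_int (bernoulli_den' m) * (of_int (power_sum m (p ^ a)) - of_nat (p ^ a) * bernoulli m)
    / (of_nat m * of_nat (p ^ a) ^ 2) \<in> plocal p"
proof -
  let ?D = "of_int (bernoulli_den' m) :: rat" and ?q = "of_nat (p ^ a) :: rat"
  have p0: "(of_nat p :: rat) \<noteq> 0" and q0: "?q \<noteq> 0"
    using assms(1) by (auto simp: prime_gt_0_nat)
  obtain e where e: "bernoulli_den' m = 12 * e"
    using twelve_dvd_bernoulli_den'[OF assms(2,3)] by blast
  have m2: "m \<ge> 2" using assms by (auto elim!: evenE)
  \<comment> \<open>One factor \<open>p\<close> is split off \<open>q\<close>; its powers alone
    cancel the denominators.\<close>
  have qp: "?q ^ n = of_nat (p ^ (a - 1)) ^ n * of_nat p ^ n" for n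
    using assms(4) by (cases a) (auto simp flip: power_mult_distrib simp: mult.commute)
  let ?f = "\<lambda>i. of_nat (m choose i) * bernoulli (m - i) * ?q ^ (i + 1) / of_nat (i + 1)"
  have "?D * ?f i / (of_nat m * ?q ^ 2) \<in> plocal p" if i: "i \<in> {2..m}" for i
  proof -
    have bin: "of_nat (m choose i) = of_nat m * (of_nat ((m - 1) choose (i - 1)) / of_nat i :: rat)"
      using times_binomial_minus1_eq[of i m] i by (simp add: field_simps flip: of_nat_mult)
    have qi: "?q ^ (i + 1) = ?q ^ 2 * ?q ^ (i - 1)"
      using i by (simp flip: power_add)
    have "?D * ?f i / (of_nat m * ?q ^ 2) =
       of_int e * of_nat ((m - 1) choose (i - 1)) * of_nat (p ^ (a - 1)) ^ (i - 1) * (of_nat p * bernoulli (m - i)) *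
        (12 / of_nat p * (of_nat p ^ (i - 1) / (of_nat i * of_nat (i + 1))))"
      using p0 q0 m2 i unfolding bin qi e qp[of "i - 1"] by (simp add: field_simps del: of_nat_power of_nat_add of_nat_Suc)
    also have "\<dots> \<in> plocal p"
      using assms(1) i
      by (intro plocal_mult plocal_twelve_power_div plocal_prime_mult_bernoulli plocal_power plocal_of_nat plocal_of_int) auto
    finally show ?thesis .
  qed
  moreover have "?D * (?q ^ m / 2) / (of_nat m * ?q ^ 2) \<in> plocal p"
  proof -
    have qm: "?q ^ m = ?q ^ 2 * ?q ^ (m - 2)"
      using m2 by (metis power_add le_add_diff_inverse)
    have "?D * (?q ^ m / 2) / (of_nat m * ?q ^ 2) =
      of_int e * of_nat (p ^ (a - 1)) ^ (m - 2) * (6 * (of_nat p ^ (m - 2) / of_nat m))"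
      using p0 q0 m2 unfolding qm e qp[of "m - 2"] by (simp add: field_simps del: of_nat_power)
    also have "\<dots> \<in> plocal p"
      using assms(1) m2
      by (intro plocal_mult plocal_six_power_div plocal_power plocal_of_nat plocal_of_int) auto
    finally show ?thesis .
  qed
  ultimately show ?thesis
    using assms(1) unfolding power_sum_bernoulli_even[OF assms(2,3)]
    by (auto simp: diff_divide_distrib sum_divide_distrib right_diff_distrib sum_distrib_left
        intro!: plocal_diff plocal_sum)
qed

subsection \<open>Voronoi's congruence\<close>

lemma sum_residues_mult:
  fixes c :: int and n :: nat and f :: "int \<Rightarrow> 'a :: comm_monoid_add"
  assumes "coprime c (int n)" "n > 0"
  shows "(\<Sum>s<n. f ((int s * c) mod int n)) = (\<Sum>s<n. f (int s))"
proof -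
  let ?g = "\<lambda>s. nat ((int s * c) mod int n)"
  have "inj_on ?g {..<n}"
  proof (rule inj_onI)
    fix x y assume xy: "x \<in> {..<n}" "y \<in> {..<n}" "?g x = ?g y"
    then have "[int x * c = int y * c] (mod int n)"
      using assms(2) by (simp add: cong_def eq_nat_nat_iff)
    then have "[int x = int y] (mod int n)"
      using assms(1) by (simp add: cong_mult_rcancel)
    then show "x = y"
      using xy(1,2) by (simp add: cong_int_iff cong_def)
  qed
  moreover have "?g ` {..<n} \<subseteq> {..<n}"
    using assms(2) by (auto simp: nat_less_iff)
  ultimately have "bij_betw ?g {..<n} {..<n}"
    by (simp add: bij_betw_def endo_inj_surj)
  then have "(\<Sum>s<n. f (int (?g s))) = (\<Sum>s<n. f (int s))"
    by (rule sum.reindex_bij_betw)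
  then show ?thesis using assms(2) by simp
qed

lemma diff_power_taylor:
  fixes x y :: "'a :: comm_ring_1"
  assumes "m > 0"
  shows "(x - y) ^ m = x ^ m - of_nat m * y * x ^ (m - 1) +
    (\<Sum>i=2..m. of_nat (m choose i) * (- y) ^ i * x ^ (m - i))"
proof -
  let ?f = "\<lambda>i. of_nat (m choose i) * (- y) ^ i * x ^ (m - i)"
  have "{..m} = insert 0 (insert 1 {2..m})" using assms by auto
  then have "(\<Sum>i\<le>m. ?f i) = ?f 0 + ?f 1 + (\<Sum>i=2..m. ?f i)" by simp
  then show ?thesis
    using binomial_ring[of "- y" x m] by simp
qed

text \<open>The modulus \<open>q\<close> and the length \<open>n\<close> are separate because the
  theorem divides by \<open>p ^ a\<close> but sums up to \<open>p ^ (a + b)\<close>. Integer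
  \<open>div\<close> rounds down, so it is the floor for negative \<open>c\<close> too.\<close>

definition voronoi_sum :: "nat \<Rightarrow> int \<Rightarrow> nat \<Rightarrow> nat \<Rightarrow> int" where
  "voronoi_sum m c q n = (\<Sum>s<n. int s ^ (m - 1) * ((int s * c) div int q))"

lemma voronoi_congruence:
  fixes c :: int
  assumes "prime p" "coprime c (int p)" "even m" "m > 0" "a > 0"
  shows "int p ^ a dvd bernoulli_num' m * (c ^ m - 1) -
    bernoulli_den' m * c ^ (m - 1) * voronoi_sum m c (p ^ a) (p ^ a)"
proof -
  let ?D = "of_int (bernoulli_den' m) :: rat" and ?q = "of_nat (p ^ a) :: rat"
  have p0: "(of_nat p :: rat) \<noteq> 0" and q0: "?q \<noteq> 0"
    using assms(1) by (auto simp: prime_gt_0_nat)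
  obtain e where e: "bernoulli_den' m = 12 * e"
    using twelve_dvd_bernoulli_den'[OF assms(3,4)] by blast
  have qp: "?q ^ n = of_nat (p ^ (a - 1)) ^ n * of_nat p ^ n" for n
    using assms(5) by (cases a) (auto simp flip: power_mult_distrib simp: mult.commute)
  define S where "S = (of_int (power_sum m (p ^ a)) :: rat)"
  define V where "V = (of_int (voronoi_sum m c (p ^ a) (p ^ a)) :: rat)"
  define x where "x = (\<lambda>s::nat. of_int (int s * c) :: rat)"
  define t where "t = (\<lambda>s::nat. of_int ((int s * c) div int (p ^ a)) :: rat)"
  \<comment> \<open>The part of order at least 2 in \<open>q\<close> of the expansion of all
    \<open>m\<close>-th powers.\<close>
  define R where "R = (\<Sum>s<p ^ a. \<Sum>i=2..m. of_nat (m choose i) * (- (?q * t s)) ^ i * x s ^ (m - i))"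
  have "S = (\<Sum>s<p ^ a. (x s - ?q * t s) ^ m)"
  proof -
    have "S = (\<Sum>s<p ^ a. of_int (int s) ^ m)" by (simp add: S_def power_sum_def)
    also have "\<dots> = (\<Sum>s<p ^ a. of_int ((int s * c) mod int (p ^ a)) ^ m)"
      using assms(1,2)
      by (intro sum_residues_mult[symmetric]) (auto simp: prime_gt_0_nat)
    also have "\<dots> = (\<Sum>s<p ^ a. (x s - ?q * t s) ^ m)"
      by (simp add: x_def t_def minus_mult_div_eq_mod[symmetric])
    finally show ?thesis .
  qed
  also have "\<dots> = (\<Sum>s<p ^ a. x s ^ m) - of_nat m * ?q * (\<Sum>s<p ^ a. t s * x s ^ (m - 1)) + R"
    using assms(4)
    by (simp add: diff_power_taylor R_def sum.distrib sum_subtractf sum_distrib_left mult_ac)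
  also have "(\<Sum>s<p ^ a. x s ^ m) = of_int c ^ m * S"
    by (simp add: x_def S_def power_sum_def power_mult_distrib sum_distrib_left mult_ac)
  also have "(\<Sum>s<p ^ a. t s * x s ^ (m - 1)) = of_int c ^ (m - 1) * V"
    by (simp add: x_def t_def V_def voronoi_sum_def power_mult_distrib sum_distrib_left mult_ac)
  finally have S: "(of_int c ^ m - 1) * S = of_nat m * ?q * of_int c ^ (m - 1) * V - R"
    by (simp add: algebra_simps)
  \<comment> \<open>Absorbing \<open>m\<close> into the binomial coefficient leaves
    \<open>q ^ (i - 2) / i\<close>, covered by half of the factor 12.\<close>
  have R: "?D * R / (of_nat m * ?q ^ 2) \<in> plocal p"
  proof -
    have "?D * (of_nat (m choose i) * (- (?q * t s)) ^ i * x s ^ (m - i)) / (of_nat m * ?q ^ 2) \<in> plocal p"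
      if i: "i \<in> {2..m}" for s i
    proof -
      have bin: "of_nat (m choose i) = of_nat m * (of_nat ((m - 1) choose (i - 1)) / of_nat i :: rat)"
        using times_binomial_minus1_eq[of i m] i by (simp add: field_simps flip: of_nat_mult)
      have "(- (?q * t s)) ^ i = (- t s) ^ i * ?q ^ i"
        by (simp flip: power_mult_distrib add: mult.commute)
      also have "?q ^ i = ?q ^ 2 * ?q ^ (i - 2)"
        using i by (metis atLeastAtMost_iff power_add le_add_diff_inverse)
      finally have pw: "(- (?q * t s)) ^ i = (- t s) ^ i * (?q ^ 2 * ?q ^ (i - 2))" .
      have "?D * (of_nat (m choose i) * (- (?q * t s)) ^ i * x s ^ (m - i)) / (of_nat m * ?q ^ 2) =
         2 * of_int e * of_nat ((m - 1) choose (i - 1)) * (- t s) ^ i * x s ^ (m - i) *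
          of_nat (p ^ (a - 1)) ^ (i - 2) * (6 * (of_nat p ^ (i - 2) / of_nat i))"
        using p0 q0 i assms(4) unfolding bin pw e qp[of "i - 2"] by (simp add: field_simps del: of_nat_power)
      also have "\<dots> \<in> plocal p"
        using assms(1) i unfolding t_def x_def
        by (intro plocal_mult plocal_six_power_div plocal_power plocal_minus plocal_of_nat plocal_of_int plocal_numeral) auto
      finally show ?thesis .
    qed
    then show ?thesis
      using assms(1) unfolding R_def sum_distrib_left sum_divide_distrib
      by (intro plocal_sum) auto
  qed
  have SB: "?D * (S - ?q * bernoulli m) / (of_nat m * ?q ^ 2) \<in> plocal p"
    unfolding S_def using assms by (intro den'_power_sum_bernoulli)
  \<comment> \<open>Multiplying \<open>S\<close> by \<open>?D / (m * q ^ 2)\<close> and writing the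
    numerator as \<open>?D * bernoulli m / m\<close> leaves just the two integral errors
    \<open>SB\<close> and \<open>R\<close>.\<close>
  have "of_int (bernoulli_num' m * (c ^ m - 1) -
      bernoulli_den' m * c ^ (m - 1) * voronoi_sum m c (p ^ a) (p ^ a)) / ?q =
    - (of_int (c ^ m - 1) * (?D * (S - ?q * bernoulli m) / (of_nat m * ?q ^ 2)))
    - ?D * R / (of_nat m * ?q ^ 2)"
  proof -
    have N: "of_int (bernoulli_num' m) = ?D * bernoulli m / of_nat m"
      using bernoulli_den'_mult[OF assms(4)] assms(4) by simp
    have "of_int (c ^ m - 1) * (?D * (S - ?q * bernoulli m) / (of_nat m * ?q ^ 2)) =
      ?D * ((of_int c ^ m - 1) * S - (of_int c ^ m - 1) * ?q * bernoulli m) / (of_nat m * ?q ^ 2)"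
      by (simp add: algebra_simps)
    also have "\<dots> = ?D * (of_nat m * ?q * of_int c ^ (m - 1) * V - R - (of_int c ^ m - 1) * ?q * bernoulli m) / (of_nat m * ?q ^ 2)"
      by (simp only: S)
    finally have *: "of_int (c ^ m - 1) * (?D * (S - ?q * bernoulli m) / (of_nat m * ?q ^ 2)) =
      ?D * (of_nat m * ?q * of_int c ^ (m - 1) * V - R - (of_int c ^ m - 1) * ?q * bernoulli m) / (of_nat m * ?q ^ 2)" .
    show ?thesis
      unfolding * using q0 assms(4)
      by (simp add: N V_def field_simps power2_eq_square del: of_nat_power)
  qed
  also have "\<dots> \<in> plocal p"
    by (intro plocal_diff plocal_minus plocal_mult[OF assms(1) plocal_of_int] R SB assms(1))
  finally show ?thesis
    by (rule plocal_dvd[OF assms(1)])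
qed

section \<open>From \<open>b = 0\<close> to general \<open>b\<close>\<close>

lemma two_mult_power_sum_1: "2 * power_sum 1 n = int n * (int n - 1)"
  by (induction n) (auto simp: power_sum_def algebra_simps)

lemma six_mult_power_sum_2: "6 * power_sum 2 n = int n * (int n - 1) * (2 * int n - 1)"
  by (induction n) (auto simp: power_sum_def algebra_simps power2_eq_square)

lemma sum_lessThan_mult:
  fixes f :: "nat \<Rightarrow> 'a :: comm_monoid_add"
  shows "(\<Sum>s<q * n. f s) = (\<Sum>u<q. \<Sum>v<n. f (u + q * v))"
proof -
  have "(\<Sum>s\<in>{v * q..<v * q + q}. f s) = (\<Sum>u<q. f (u + v * q))" for v
    using sum.shift_bounds_nat_ivl[of f 0 "v * q" q] by (simp add: lessThan_atLeast0 add.commute)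
  then have "(\<Sum>s<n * q. f s) = (\<Sum>v<n. \<Sum>u<q. f (u + v * q))"
    using sum.nat_group[of f q n] by simp
  then show ?thesis by (subst sum.swap) (simp add: mult.commute)
qed

text \<open>Pairing \<open>s\<close> with \<open>n - s\<close>, the odd powers cancel modulo
  \<open>n\<close>; doubling the sum avoids treating the midpoint separately.\<close>

lemma power_sum_odd_dvd:
  assumes "odd m"
  shows "int n dvd 2 * power_sum m n"
proof (cases "n = 0")
  case False
  have "power_sum m n = (\<Sum>s\<in>{1..<n}. int s ^ m)"
    unfolding power_sum_def using False assms 
    by (intro sum.mono_neutral_right) (auto simp: odd_pos not_less_eq_eq)
  also have "\<dots> = (\<Sum>s\<in>{1..<n}. int (n - s) ^ m)"
    by (rule sum.reindex_bij_witness[of _ "\<lambda>s. n - s" "\<lambda>s. n - s"]) auto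
  finally have "2 * power_sum m n = (\<Sum>s\<in>{1..<n}. int s ^ m + int (n - s) ^ m)"
    using \<open>power_sum m n = (\<Sum>s\<in>{1..<n}. int s ^ m)\<close> by (simp add: sum.distrib)
  also have "int n dvd \<dots>"
  proof (rule dvd_sum)
    fix s assume s: "s \<in> {1..<n}"
    have "[int s ^ m + int (n - s) ^ m = int s ^ m + (- int s) ^ m] (mod int n)"
      using s by (intro cong_add cong_pow) (auto simp: of_nat_diff cong_iff_dvd_diff)
    then show "int n dvd int s ^ m + int (n - s) ^ m"
      using assms by (simp add: cong_0_iff)
  qed
  finally show ?thesis .
qed (simp add: power_sum_def)

text \<open>Modulo \<open>p ^ b\<close>, the sum up to \<open>p ^ (b + 1)\<close> is
  \<open>p\<close> copies of the sum up to \<open>p ^ b\<close>, so the induction hypothesis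
  applies.\<close>

lemma power_sum_prime_power_dvd:
  "int (p ^ b) dvd int p * power_sum j (p ^ b)"
proof (induction b)
  case (Suc b)
  let ?P = "p ^ b"
  have "power_sum j (p ^ Suc b) = (\<Sum>u<?P. \<Sum>v<p. int (u + ?P * v) ^ j)"
    unfolding power_sum_def by (subst sum_lessThan_mult[symmetric]) (simp add: mult.commute)
  also have "[\<dots> = (\<Sum>u<?P. \<Sum>v<p. int u ^ j)] (mod int ?P)"
    by (intro cong_sum cong_pow) (simp add: cong_iff_dvd_diff)
  also have "(\<Sum>u<?P. \<Sum>v<p. int u ^ j) = int p * power_sum j ?P"
    by (simp add: power_sum_def sum_distrib_left)
  also have "[\<dots> = 0] (mod int ?P)"
    using Suc by (simp add: cong_0_iff)
  finally have "int ?P dvd power_sum j (p ^ Suc b)" by (simp only: cong_0_iff)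
  then show ?case by (simp add: mult_dvd_mono)
qed simp

text \<open>Kills the terms of positive order in \<open>q\<close> in the expansion below. For
  \<open>i = 1\<close> the closed forms have denominators 2 and 6, absorbed by 12; for larger
  \<open>i\<close> a second \<open>q\<close> supplies the missing \<open>p\<close>.\<close>

lemma dvd_power_mult_power_sum:
  fixes d :: int
  assumes "12 dvd d" "p dvd q" "i \<ge> 1" "j = i \<or> j = i + 1"
  shows "int (q * p ^ b) dvd d * int q ^ i * power_sum j (p ^ b)"
proof -
  obtain e where e: "d = 12 * e" using assms(1) by blast
  show ?thesis
  proof (cases "i = 1")
    case True
    have "int (p ^ b) dvd 6 * (2 * power_sum 1 (p ^ b))"
      unfolding two_mult_power_sum_1 by simp
    moreover have "int (p ^ b) dvd 2 * (6 * power_sum 2 (p ^ b))"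
      unfolding six_mult_power_sum_2 by simp
    moreover have "j = 1 \<or> j = 2" using assms(4) True by auto
    ultimately have "int (p ^ b) dvd 12 * power_sum j (p ^ b)"
      by (elim disjE) (simp_all only: mult.assoc[symmetric], simp_all)
    then have "int q * int (p ^ b) dvd (e * int q) * (12 * power_sum j (p ^ b))"
      by (intro mult_dvd_mono) auto
    then show ?thesis by (simp add: e True mult_ac)
  next
    case False
    then obtain k where k: "i = Suc (Suc k)"
      using assms(3) by (metis One_nat_def Suc_le_D old.nat.exhaust)
    obtain r where r: "q = p * r" using assms(2) by blast
    have "int q * int (p ^ b) dvd (int q * (d * int q ^ k * int r)) * (int p * power_sum j (p ^ b))"
      by (intro mult_dvd_mono power_sum_prime_power_dvd) auto
    then show ?thesis by (simp add: k r mult_ac)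
  qed
qed

text \<open>For \<open>s = u + q * v\<close> the quotient is \<open>T u + v * c\<close>, where
  \<open>T u\<close> is the one for \<open>u\<close>. Only the term of order 0 in \<open>q\<close>
  of the power of \<open>s\<close> survives.\<close>

lemma voronoi_sum_mult_cong:
  assumes "12 dvd d" "p dvd q" "q > 0" "even m" "m > 0"
  shows "[d * voronoi_sum m c q (q * p ^ b) = d * (int (p ^ b) * voronoi_sum m c q q)] (mod int (q * p ^ b))"
proof -
  let ?P = "p ^ b"
  define n where "n = m - 1"
  have n: "odd n" using assms(4,5) by (simp add: n_def)
  define T where "T = (\<lambda>u. (int u * c) div int q)"
  have T: "(int (u + q * v) * c) div int q = T u + int v * c" for u v
  proof -
    have "int (u + q * v) * c = int u * c + (int v * c) * int q" by (simp add: algebra_simps)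
    then show ?thesis using assms(3) by (simp add: T_def)
  qed
  have inner: "[d * (\<Sum>v<?P. int (u + q * v) ^ n * (T u + int v * c)) =
      d * (int u ^ n * (int ?P * T u + c * power_sum 1 ?P))] (mod int (q * ?P))" for u
  proof -
    let ?g = "\<lambda>i. d * int q ^ i * power_sum i ?P * (of_nat (n choose i) * int u ^ (n - i) * T u)
        + d * int q ^ i * power_sum (i + 1) ?P * (of_nat (n choose i) * int u ^ (n - i) * c)"
    have "int (u + q * v) ^ n = (\<Sum>i\<le>n. of_nat (n choose i) * (int q * int v) ^ i * int u ^ (n - i))" for v
      using binomial_ring[of "int q * int v" "int u" n] by (simp add: add.commute)
    then have "d * (\<Sum>v<?P. int (u + q * v) ^ n * (T u + int v * c)) =
      (\<Sum>v<?P. \<Sum>i\<le>n. d * (of_nat (n choose i) * (int q * int v) ^ i * int u ^ (n - i) * (T u + int v * c)))"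
      by (simp add: sum_distrib_left sum_distrib_right mult_ac)
    also have "\<dots> = (\<Sum>i\<le>n. \<Sum>v<?P. d * (of_nat (n choose i) * (int q * int v) ^ i * int u ^ (n - i) * (T u + int v * c)))"
      by (rule sum.swap)
    also have "\<dots> = (\<Sum>i\<le>n. ?g i)"
      by (rule sum.cong)
        (simp_all add: power_sum_def sum_distrib_left sum_distrib_right power_mult_distrib
          flip: sum.distrib, simp add: algebra_simps)
    also have "\<dots> = ?g 0 + (\<Sum>i\<in>{1..n}. ?g i)"
      by (simp add: atMost_atLeast0 sum.atLeast_Suc_atMost)
    also have "[\<dots> = ?g 0 + 0] (mod int (q * ?P))"
    proof (intro cong_add cong_refl)
      have "int (q * ?P) dvd (\<Sum>i\<in>{1..n}. ?g i)"
        using assms(1,2) by (intro dvd_sum dvd_add dvd_mult2 dvd_power_mult_power_sum) auto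
      then show "[(\<Sum>i\<in>{1..n}. ?g i) = 0] (mod int (q * ?P))" by (simp only: cong_0_iff)
    qed
    \<comment> \<open>Here \<open>power_sum 0 ?P\<close> is \<open>?P\<close>, because
      \<open>0 ^ 0 = 1\<close>.\<close>
    also have "?g 0 + 0 = d * (int u ^ n * (int ?P * T u + c * power_sum 1 ?P))"
      by (simp add: power_sum_def[of 0] algebra_simps)
    finally show ?thesis .
  qed
  have "d * voronoi_sum m c q (q * ?P) = (\<Sum>u<q. d * (\<Sum>v<?P. int (u + q * v) ^ n * (T u + int v * c)))"
    unfolding voronoi_sum_def sum_lessThan_mult T n_def[symmetric] sum_distrib_left[of d] ..
  also have "[\<dots> = (\<Sum>u<q. d * (int u ^ n * (int ?P * T u + c * power_sum 1 ?P)))] (mod int (q * ?P))"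
    by (intro cong_sum inner)
  also have "(\<Sum>u<q. d * (int u ^ n * (int ?P * T u + c * power_sum 1 ?P))) =
      (\<Sum>u<q. d * int ?P * (int u ^ n * T u) + d * c * power_sum 1 ?P * int u ^ n)"
    by (rule sum.cong) (simp_all add: algebra_simps)
  also have "\<dots> = d * (int ?P * voronoi_sum m c q q) + d * c * power_sum n q * power_sum 1 ?P"
    unfolding voronoi_sum_def power_sum_def[of n] T_def n_def[symmetric] sum.distrib
      sum_distrib_left[symmetric] by (simp add: mult_ac)
  \<comment> \<open>Doubled, the two power sums are divisible by \<open>q\<close> and by
    \<open>?P\<close>; the factor 4 of \<open>d\<close> allows both doublings.\<close>
  also have "[\<dots> = d * (int ?P * voronoi_sum m c q q) + 0] (mod int (q * ?P))"
  proof (intro cong_add cong_refl)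
    obtain e where e: "d = 12 * e" using assms(1) by blast
    have "int q * int ?P dvd (2 * power_sum n q) * (2 * power_sum 1 ?P)"
      using power_sum_odd_dvd[OF n, of q] two_mult_power_sum_1[of ?P] by (intro mult_dvd_mono) auto
    then have "int q * int ?P dvd (3 * e * c) * ((2 * power_sum n q) * (2 * power_sum 1 ?P))"
      by (rule dvd_mult)
    then show "[d * c * power_sum n q * power_sum 1 ?P = 0] (mod int (q * ?P))"
      by (simp add: cong_0_iff e mult_ac)
  qed
  finally show ?thesis by simp
qed

text \<open>Settles the case \<open>a = 0\<close>. After division by \<open>p ^ b\<close> the power
  sum is \<open>bernoulli m\<close> up to the error bounded before, and the denominator times
  \<open>bernoulli m\<close> is an integer.\<close>

lemma den'_mult_power_sum_dvd:
  assumes "prime p" "even m" "m > 0"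
  shows "int p ^ b dvd bernoulli_den' m * power_sum m (p ^ b)"
proof (cases "b = 0")
  case False
  let ?D = "of_int (bernoulli_den' m) :: rat" and ?q = "of_nat (p ^ b) :: rat"
  have p0: "(of_nat p :: rat) \<noteq> 0" using assms(1) by (auto simp: prime_gt_0_nat)
  have "of_int (bernoulli_den' m * power_sum m (p ^ b)) / ?q =
    of_nat m * ?q * (?D * (of_int (power_sum m (p ^ b)) - ?q * bernoulli m) / (of_nat m * ?q ^ 2))
    + ?D * bernoulli m"
    using p0 assms(3) by (simp add: field_simps power2_eq_square del: of_nat_power)
  also have "\<dots> \<in> plocal p"
    using False assms unfolding bernoulli_den'_mult[OF assms(3)]
    by (intro plocal_add plocal_mult plocal_of_nat plocal_of_int den'_power_sum_bernoulli) auto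
  finally show ?thesis by (rule plocal_dvd[OF assms(1)])
qed simp

theorem theorem9:
  fixes p a b k :: nat and c :: int
  assumes "prime p"
    and "coprime c (int p)"
    and "k \<ge> 1"
  shows "[bernoulli_num' (2 * k) * int p ^ b * (c ^ (2 * k) - 1) =
          bernoulli_den' (2 * k) * c ^ (2 * k - 1) *
            (\<Sum>s = 0..p ^ (a + b) - 1. int s ^ (2 * k - 1) *
               \<lfloor>real s * real_of_int c / real p ^ a\<rfloor>)] (mod (int p ^ (a + b)))"
proof -
  define m where "m = 2 * k"
  have m: "even m" "m > 0" using assms(3) by (auto simp: m_def)
  have p: "p > 0" using assms(1) by (rule prime_gt_0_nat)
  have "\<lfloor>real s * real_of_int c / real p ^ a\<rfloor> = (int s * c) div int (p ^ a)" for s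
    using floor_divide_of_int_eq[of "int s * c" "int (p ^ a)", where ?'a = real] by simp
  moreover have "{0..p ^ (a + b) - 1} = {..<p ^ a * p ^ b}"
    using p by (auto simp: power_add) (metis Suc_pred le_imp_less_Suc less_Suc_eq_le nat_0_less_mult_iff zero_less_power)+
  ultimately have sum: "(\<Sum>s = 0..p ^ (a + b) - 1. int s ^ (2 * k - 1) *
      \<lfloor>real s * real_of_int c / real p ^ a\<rfloor>) = voronoi_sum m c (p ^ a) (p ^ a * p ^ b)"
    by (simp add: voronoi_sum_def m_def)
  let ?N = "bernoulli_num' m" and ?D = "bernoulli_den' m"
  have "[?N * int p ^ b * (c ^ m - 1) = ?D * c ^ (m - 1) * voronoi_sum m c (p ^ a) (p ^ a * p ^ b)]
      (mod int (p ^ a * p ^ b))"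
  proof (cases "a = 0")
    case True
    \<comment> \<open>For \<open>a = 0\<close> the floor is \<open>s * c\<close> itself, and both
      sides of the congruence vanish modulo \<open>p ^ b\<close>.\<close>
    have "voronoi_sum m c 1 (p ^ b) = c * power_sum m (p ^ b)"
      using m(2) by (cases m) (simp_all add: voronoi_sum_def power_sum_def sum_distrib_left mult_ac)
    moreover have "int p ^ b dvd ?D * power_sum m (p ^ b)"
      using assms(1) m by (rule den'_mult_power_sum_dvd)
    then have "int p ^ b dvd (c ^ (m - 1) * c) * (?D * power_sum m (p ^ b))"
      by (rule dvd_mult)
    ultimately show ?thesis
      by (simp add: True cong_iff_dvd_diff mult_ac dvd_diff)
  next
    case False
    have 12: "12 dvd ?D" using m by (rule twelve_dvd_bernoulli_den')
    \<comment> \<open>Voronoi's congruence modulo \<open>p ^ a\<close>, multiplied through by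
      \<open>p ^ b\<close>.\<close>
    have "int p ^ b * int p ^ a dvd int p ^ b * (?N * (c ^ m - 1) - ?D * c ^ (m - 1) * voronoi_sum m c (p ^ a) (p ^ a))"
      using assms(1,2) m False by (intro mult_dvd_mono voronoi_congruence) auto
    then have "[?N * int p ^ b * (c ^ m - 1) =
        c ^ (m - 1) * (?D * (int (p ^ b) * voronoi_sum m c (p ^ a) (p ^ a)))] (mod int (p ^ a * p ^ b))"
      by (simp add: cong_iff_dvd_diff algebra_simps)
    also have "[c ^ (m - 1) * (?D * (int (p ^ b) * voronoi_sum m c (p ^ a) (p ^ a))) =
        c ^ (m - 1) * (?D * voronoi_sum m c (p ^ a) (p ^ a * p ^ b))] (mod int (p ^ a * p ^ b))"
      using False p m 12 by (intro cong_mult cong_refl cong_sym[OF voronoi_sum_mult_cong]) auto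
    finally show ?thesis by (simp add: mult_ac)
  qed
  then show ?thesis
    unfolding sum unfolding m_def[symmetric] by (simp add: power_add)
qed

end
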